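(* Let $\Phi:T\times\mathbb{R}^n\rightrightarrows\mathbb{R}^m$ be a set-valued normal integrand defined on a complete finite measure space $(T,\mathcal{A},\mu)$, and let $\bar x\in\operatorname{dom}E_\Phi$. Then $\Phi$ is integrably locally Lipschitzian around $\bar x$ if and only if there exist $\eta>0$, $\ell\in L^1(T,\mathbb{R}_+)$, and $\hat T\in\mathcal{A}$ with $\mu(T\setminus\hat T)=0$ such that $$\sup\{\|x^*\|\;:\;x^*\in\hat D^*\Phi_t(x,y)(y^* )\}\le\ell(t)\|y^*\|\quad\text{for all } y\in\Phi_t(x)\text{ and } t\in\hat T$$ whenever $x\in\mathbb{B}_\eta(\bar x)$ and $y^*\in\mathbb{R}^m$.
   Context: $\mathbb{R}_+:=\{\alpha\in\mathbb{R}:\alpha>0\}$; $L^1(T,\cdot)$ is the space of integrable functions; $\mathbb{B}_r(x)$ is the closed ball, $\mathbb{B}$ the closed unit ball. For $\Phi:T\times\mathbb{R}^n\rightrightarrows\mathbb{R}^m$ write $\Phi_t:=\Phi(t,\cdot)$. $\Phi$ is a set-valued normal integrand if $\operatorname{gph}\Phi_t$ is closed for all $t\in T$ and $\operatorname{gph}\Phi\in\mathcal{A}\otimes\mathcal{B}(\mathbb{R}^n\times\mathbb{R}^m)$. The expected-integral multifunction is the Aumann integral $E_\Phi(x):=\int_T\Phi_t(x)\,d\mu=\{\int_T\mathsf{y}(t)d\mu:\mathsf{y}\in L^1(T,\mathbb{R}^m),\ \mathsf{y}(t)\in\Phi_t(x)\text{ a.e.}\}$, with $\operatorname{dom}E_\Phi=\{x:E_\Phi(x)\ne\emptyset\}$.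 Integrably locally Lipschitzian around $\bar x$: there exist $\eta>0$, $\ell\in L^1(T,\mathbb{R}_+)$ and $\hat T\in\mathcal{A}$ with $\mu(T\setminus\hat T)=0$ such that $\Phi_t(x)\subset\Phi_t(x')+\ell(t)\|x-x'\|\mathbb{B}$ for all $t\in\hat T$ and $x,x'\in\mathbb{B}_\eta(\bar x)$. Regular normal cone to $\Omega$ at $\bar z\in\Omega$: $\hat N(\bar z;\Omega)=\{z^*:\limsup_{z\to\bar z,\,z\in\Omega}\langle z^*,z-\bar z\rangle/\|z-\bar z\|\le 0\}$ (and $\emptyset$ if $\bar z\notin\Omega$). Regular coderivative of $G:\mathbb{R}^n\rightrightarrows\mathbb{R}^m$ at $(x,y)\in\operatorname{gph}G$: $\hat D^*G(x,y)(y^* )=\{x^*:(x^*,-y^* )\in\hat N((x,y);\operatorname{gph}G)\}$. An inequality on a supremum over an empty set is regarded as satisfied. *)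

theory Defs
  imports "HOL-Analysis.Analysis"
begin

text \<open>
  A multifunction \<open>\<Phi> : T \<times> R^n \<rightrightarrows> R^m\<close> is a curried function
  \<open>\<Phi> :: 't \<Rightarrow> 'a \<Rightarrow> 'b set\<close> with \<open>T = space M\<close>; its section \<open>\<Phi>\<^sub>t\<close> is the
  partial application \<open>\<Phi> t\<close>.  Values of \<open>\<Phi> t\<close> for \<open>t \<notin> space M\<close> play no role.
\<close>

definition gph :: "('a \<Rightarrow> 'b set) \<Rightarrow> ('a \<times> 'b) set" where
  "gph G = {(x, y). y \<in> G x}"

definition set_valued_normal_integrand ::
    "'t measure \<Rightarrow> ('t \<Rightarrow> 'a::euclidean_space \<Rightarrow> 'b::euclidean_space set) \<Rightarrow> bool" where
  "set_valued_normal_integrand M \<Phi> \<longleftrightarrow>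
     (\<forall>t\<in>space M. closed (gph (\<Phi> t))) \<and>
     {(t, z). t \<in> space M \<and> z \<in> gph (\<Phi> t)} \<in> sets (M \<Otimes>\<^sub>M borel)"

definition expected_integral ::
    "'t measure \<Rightarrow> ('t \<Rightarrow> 'a \<Rightarrow> 'b::euclidean_space set) \<Rightarrow> 'a \<Rightarrow> 'b set" where
  "expected_integral M \<Phi> x =
     {lebesgue_integral M y | y. integrable M y \<and> (AE t in M. y t \<in> \<Phi> t x)}"

definition set_dom :: "('a \<Rightarrow> 'b set) \<Rightarrow> 'a set" where
  "set_dom G = {x. G x \<noteq> {}}"

text \<open>The space \<open>L\<^sup>1(T, R\<^sub>+)\<close>, where \<open>R\<^sub>+\<close> is the set of \<^emph>\<open>strictly\<close> positive reals.\<close>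

definition L1_pos :: "'t measure \<Rightarrow> ('t \<Rightarrow> real) set" where
  "L1_pos M = {l. integrable M l \<and> (\<forall>t\<in>space M. 0 < l t)}"

definition integrably_locally_Lipschitzian ::
    "'t measure \<Rightarrow> ('t \<Rightarrow> 'a::euclidean_space \<Rightarrow> 'b::euclidean_space set) \<Rightarrow> 'a \<Rightarrow> bool" where
  "integrably_locally_Lipschitzian M \<Phi> xbar \<longleftrightarrow>
     (\<exists>\<eta>>0. \<exists>l\<in>L1_pos M. \<exists>That\<in>sets M. emeasure M (space M - That) = 0 \<and>
        (\<forall>t\<in>That. \<forall>x\<in>cball xbar \<eta>. \<forall>x'\<in>cball xbar \<eta>.
           \<Phi> t x \<subseteq> {y + (l t * norm (x - x')) *\<^sub>R b | y b. y \<in> \<Phi> t x' \<and> b \<in> cball 0 1}))"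

text \<open>
  The filter \<open>at z within \<Omega>\<close> excludes the point \<open>z\<close>, where the quotient is undefined.  At an isolated
  point of \<open>\<Omega>\<close> the upper limit is \<open>-\<infinity>\<close>, so the cone is the whole space.
\<close>

definition regular_normal_cone :: "'a::euclidean_space \<Rightarrow> 'a set \<Rightarrow> 'a set" where
  "regular_normal_cone z \<Omega> =
     (if z \<in> \<Omega>
      then {zs. Limsup (at z within \<Omega>) (\<lambda>w. ereal (zs \<bullet> (w - z) / norm (w - z))) \<le> 0}
      else {})"

definition regular_coderivative ::
    "('a::euclidean_space \<Rightarrow> 'b::euclidean_space set) \<Rightarrow> 'a \<Rightarrow> 'b \<Rightarrow> 'b \<Rightarrow> 'a set" where
  "regular_coderivative G x y ys = {xs. (xs, - ys) \<in> regular_normal_cone (x, y) (gph G)}"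

end

theory Submission
  imports Defs
begin

text \<open>
  Everything happens for a fixed \<open>t\<close>.  If \<open>G\<close> is Lipschitzian, testing a normal \<open>(x\<^sup>*, -y\<^sup>*)\<close> along points
  of the graph above \<open>x + s x\<^sup>*\<close> bounds \<open>x\<^sup>*\<close>.  Conversely, given \<open>y \<in> G x\<close> and a target \<open>x'\<close>, minimize
  \<open>\<parallel>u - x'\<parallel> + \<parallel>(w - y, e)\<parallel> / l\<close> over \<open>(u, w)\<close> in the closed graph of \<open>G\<close>, where \<open>e > 0\<close> smooths the
  second norm at \<open>w = y\<close>.  At a minimizer with \<open>u \<noteq> x'\<close> the negative gradient is a regular normal
  \<open>(x\<^sup>*, -y\<^sup>*)\<close> with \<open>\<parallel>x\<^sup>*\<parallel> = 1\<close> and \<open>\<parallel>y\<^sup>*\<parallel> < 1 / l\<close>, violating the coderivative estimate.  Hence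
  \<open>u = x'\<close>, and comparing with the value at \<open>(x, y)\<close> bounds \<open>\<parallel>w - y\<parallel>\<close>.
\<close>

text \<open>The filter excludes \<open>w = z\<close>, so the quotient can be multiplied out. The
  resulting epsilon form avoids extended reals; at an isolated point both sides hold trivially,
  since the filter is then \<open>bot\<close>.\<close>

lemma regular_normal_cone_iff:
  fixes z :: "'a::euclidean_space"
  shows "zs \<in> regular_normal_cone z \<Omega> \<longleftrightarrow>
    z \<in> \<Omega> \<and> (\<forall>e>0. \<forall>\<^sub>F w in at z within \<Omega>. zs \<bullet> (w - z) \<le> e * norm (w - z))"
proof -
  let ?q = "\<lambda>w. zs \<bullet> (w - z) / norm (w - z)"
  have le: "(\<forall>\<^sub>F w in at z within \<Omega>. ?q w \<le> e) \<longleftrightarrow>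
      (\<forall>\<^sub>F w in at z within \<Omega>. zs \<bullet> (w - z) \<le> e * norm (w - z))" for e
    by (rule eventually_cong[OF eventually_at_filter[THEN iffD2, OF always_eventually]])
       (auto simp: divide_le_eq)
  have "Limsup (at z within \<Omega>) (\<lambda>w. ereal (?q w)) \<le> 0 \<longleftrightarrow>
      (\<forall>e>0. \<forall>\<^sub>F w in at z within \<Omega>. ?q w \<le> e)"
  proof
    assume L: "Limsup (at z within \<Omega>) (\<lambda>w. ereal (?q w)) \<le> 0"
    show "\<forall>e>0. \<forall>\<^sub>F w in at z within \<Omega>. ?q w \<le> e"
    proof (intro allI impI)
      fix e :: real assume "e > 0"
      with L have "\<forall>\<^sub>F w in at z within \<Omega>. ereal (?q w) < ereal e"
        unfolding Limsup_le_iff by (metis ereal_less(2))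
      then show "\<forall>\<^sub>F w in at z within \<Omega>. ?q w \<le> e"
        by (rule eventually_mono) simp
    qed
  next
    assume R: "\<forall>e>0. \<forall>\<^sub>F w in at z within \<Omega>. ?q w \<le> e"
    show "Limsup (at z within \<Omega>) (\<lambda>w. ereal (?q w)) \<le> 0"
    proof (rule ereal_le_epsilon2)
      fix e :: real assume "e > 0"
      with R have "\<forall>\<^sub>F w in at z within \<Omega>. ereal (?q w) \<le> ereal e"
        by simp
      then show "Limsup (at z within \<Omega>) (\<lambda>w. ereal (?q w)) \<le> 0 + ereal e"
        by (simp add: Limsup_bounded)
    qed
  qed
  then show ?thesis
    by (simp add: regular_normal_cone_def le)
qed

text \<open>Fermat's rule: minimality gives \<open>f w - f z \<ge> 0\<close> on \<Omega>, and the
  first-order expansion turns this into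
  \<open>zs \<bullet> (w - z) \<le> o(norm (w - z))\<close>.\<close>

lemma regular_normal_cone_minimizer:
  fixes z :: "'a::euclidean_space" and f :: "'a \<Rightarrow> real"
  assumes "z \<in> \<Omega>" and min: "\<And>w. w \<in> \<Omega> \<Longrightarrow> f z \<le> f w"
    and deriv: "(f has_derivative (\<lambda>h. - (zs \<bullet> h))) (at z)"
  shows "zs \<in> regular_normal_cone z \<Omega>"
  unfolding regular_normal_cone_iff
proof (intro conjI allI impI)
  fix e :: real assume "e > 0"
  with deriv obtain d where d: "d > 0"
    "\<And>w. norm (w - z) < d \<Longrightarrow> norm (f w - f z - - (zs \<bullet> (w - z))) \<le> e * norm (w - z)"
    unfolding has_derivative_at_alt by metis
  have "zs \<bullet> (w - z) \<le> e * norm (w - z)" if "w \<in> \<Omega>" "dist w z < d" for w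
    using d(2)[of w] min[OF that(1)] that(2) by (auto simp: dist_norm)
  then show "\<forall>\<^sub>F w in at z within \<Omega>. zs \<bullet> (w - z) \<le> e * norm (w - z)"
    using d(1) by (auto simp: eventually_at)
qed fact

lemma lipschitz_imp_coderivative_bound:
  fixes G :: "'a::euclidean_space \<Rightarrow> 'b::euclidean_space set"
  assumes "l \<ge> 0" "r > 0" and y: "y \<in> G x"
    and lip: "\<And>x'. x' \<in> cball x r \<Longrightarrow> \<exists>y'\<in>G x'. norm (y' - y) \<le> l * norm (x' - x)"
    and xs: "xs \<in> regular_coderivative G x y ys"
  shows "norm xs \<le> l * norm ys"
proof (rule ccontr)
  assume neg: "\<not> norm xs \<le> l * norm ys"
  then have nz: "norm xs > 0"
    using \<open>l \<ge> 0\<close> by (meson mult_nonneg_nonneg norm_ge_zero not_le order.trans order_le_less_trans)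
  \<comment> \<open>The test displacement will have length at most \<open>s * (1 + l)\<close>. This
    \<open>e\<close> makes the resulting error, per unit of \<open>s\<close>, half of the assumed
    gap.\<close>
  define e where "e = (norm xs - l * norm ys) / 2 / (1 + l)"
  have "e * (1 + l) = (norm xs - l * norm ys) / 2"
    unfolding e_def using \<open>l \<ge> 0\<close> by (intro nonzero_eq_divide_eq[THEN iffD1]) auto
  also have "\<dots> < norm xs - l * norm ys"
    using neg by simp
  finally have e: "e * (1 + l) < norm xs - l * norm ys" .
  have "e > 0"
    using neg \<open>l \<ge> 0\<close> by (simp add: e_def)
  have "\<forall>\<^sub>F w in at (x, y) within gph G. (xs, - ys) \<bullet> (w - (x, y)) \<le> e * norm (w - (x, y))"
    using xs \<open>e > 0\<close> by (simp add: regular_coderivative_def regular_normal_cone_iff)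
  then obtain d where d: "d > 0"
    "\<And>w. w \<in> gph G \<Longrightarrow> w \<noteq> (x, y) \<Longrightarrow> dist w (x, y) < d \<Longrightarrow>
      (xs, - ys) \<bullet> (w - (x, y)) \<le> e * norm (w - (x, y))"
    by (auto simp: eventually_at)
  \<comment> \<open>The step stays in the ball where \<open>lip\<close> applies, and the factor 2
    puts the displaced graph point strictly inside the \<open>d\<close>-neighbourhood.\<close>
  define s where "s = min r (d / (2 * (1 + l)))"
  have s: "s > 0" "s \<le> r" "s * (1 + l) < d"
  proof -
    show "s > 0" "s \<le> r"
      using \<open>r > 0\<close> \<open>l \<ge> 0\<close> d(1) by (auto simp: s_def)
    have "s * (1 + l) \<le> d / (2 * (1 + l)) * (1 + l)"
      using \<open>l \<ge> 0\<close> by (intro mult_right_mono) (auto simp: s_def)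
    also have "\<dots> < d"
      using \<open>l \<ge> 0\<close> d(1) by (simp add: field_simps add_pos_nonneg)
    finally show "s * (1 + l) < d" .
  qed
  define u where "u = s *\<^sub>R sgn xs"
  have u: "norm u = s" "u \<noteq> 0" "xs \<bullet> u = s * norm xs"
    using nz s(1) by (auto simp: u_def norm_sgn sgn_div_norm power2_norm_eq_inner[symmetric] power2_eq_square)
  obtain y' where y': "y' \<in> G (x + u)" "norm (y' - y) \<le> l * s"
    using lip[of "x + u"] u s by (auto simp: dist_norm)
  have n: "norm (u, y' - y) \<le> s * (1 + l)"
    using norm_Pair_le[of u "y' - y"] y'(2) u(1) by (simp add: algebra_simps)
  have "(xs, - ys) \<bullet> (u, y' - y) \<le> e * norm (u, y' - y)"
    using d(2)[of "(x + u, y')"] y'(1) u(2) n s(3) by (simp add: gph_def dist_norm)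
  also have "\<dots> \<le> e * (s * (1 + l))"
    using n \<open>e > 0\<close> by simp
  finally have "s * norm xs \<le> ys \<bullet> (y' - y) + s * (e * (1 + l))"
    using u(3) by (simp add: algebra_simps)
  also have "ys \<bullet> (y' - y) \<le> norm ys * (l * s)"
    using norm_cauchy_schwarz[of ys "y' - y"] mult_left_mono[OF y'(2), of "norm ys"] by simp
  finally have "s * norm xs \<le> s * (l * norm ys + e * (1 + l))"
    by (simp add: algebra_simps)
  with s(1) e show False
    by simp
qed

text \<open>The radius in \<open>bound\<close> is the value of the objective at
  \<open>(x, y)\<close>, so it covers every possible minimizer.\<close>

lemma coderivative_bound_imp_near_point:
  fixes G :: "'a::euclidean_space \<Rightarrow> 'b::euclidean_space set"
  assumes cl: "closed (gph G)" and "l > 0" "e > 0" and y: "y \<in> G x"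
    and bound: "\<And>u w ys xs. norm (u - x') \<le> norm (x - x') + e / l \<Longrightarrow> w \<in> G u \<Longrightarrow>
      xs \<in> regular_coderivative G u w ys \<Longrightarrow> norm xs \<le> l * norm ys"
  shows "\<exists>w\<in>G x'. norm (w - y) \<le> l * norm (x - x') + e"
proof -
  \<comment> \<open>The pair norm is \<open>sqrt (norm (w - y)^2 + e^2)\<close>, which is
    differentiable also at \<open>w = y\<close> and dominates \<open>norm (w - y)\<close>.\<close>
  define f where "f = (\<lambda>(u, w). norm (u - x') + norm (w - y, e) / l)"
  have cont: "continuous_on S f" for S
    unfolding f_def case_prod_unfold using \<open>l > 0\<close> by (intro continuous_intros) auto
  define c where "c = norm (x - x') + e / l"
  have fxy: "f (x, y) = c"
    using \<open>e > 0\<close> by (simp add: f_def c_def norm_Pair)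
  have sub: "norm (u - x') \<le> c" "norm (w - y) \<le> l * c" if "f (u, w) \<le> c" for u w
  proof -
    have "norm (w - y) / l \<le> norm (w - y, e) / l"
      using \<open>l > 0\<close> norm_fst_le[of "w - y" e] by (simp add: divide_right_mono)
    with that have "norm (u - x') + norm (w - y) / l \<le> c"
      by (simp add: f_def)
    moreover have "norm (w - y) / l \<ge> 0"
      using \<open>l > 0\<close> by simp
    ultimately have "norm (u - x') \<le> c" "norm (w - y) / l \<le> c"
      using norm_ge_zero[of "u - x'"] by linarith+
    then show "norm (u - x') \<le> c" "norm (w - y) \<le> l * c"
      using \<open>l > 0\<close> by (auto simp: field_simps)
  qed
  \<comment> \<open>The graph may be unbounded, but \<open>f\<close> is coercive: truncating at the
    starting value \<open>c\<close> leaves a nonempty compact set, and points of the graph outside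
    it have larger values.\<close>
  define K where "K = gph G \<inter> {z. f z \<le> c}"
  have "closed {z. f z \<le> c}"
    using cont by (intro closed_Collect_le) auto
  moreover have "K \<subseteq> cball x' c \<times> cball y (l * c)"
    using sub by (auto simp: K_def dist_norm norm_minus_commute)
  then have "bounded K"
    by (rule bounded_subset[OF bounded_Times[OF bounded_cball bounded_cball]])
  ultimately have "compact K"
    using cl by (auto simp: K_def compact_eq_bounded_closed)
  moreover have xyK: "(x, y) \<in> K"
    using y fxy by (simp add: K_def gph_def)
  ultimately obtain z where "z \<in> K" and zmin: "\<And>z'. z' \<in> K \<Longrightarrow> f z \<le> f z'"
    using continuous_attains_inf[OF _ _ cont, of K] by blast
  then obtain u w where z: "z = (u, w)" and w: "w \<in> G u" and fc: "f (u, w) \<le> c"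
    by (auto simp: K_def gph_def)
  have min: "f (u, w) \<le> f z'" if "z' \<in> gph G" for z'
    using zmin[of z'] that fc z by (cases "f z' \<le> c") (auto simp: K_def)
  have "u = x'"
  proof (rule ccontr)
    assume "u \<noteq> x'"
    define a where "a = - sgn (u - x')"
    define n where "n = norm (w - y, e)"
    define b where "b = (1 / (n * l)) *\<^sub>R (w - y)"
    \<comment> \<open>The strict inequality, due to \<open>e > 0\<close>, gives
      \<open>l * norm b < 1\<close> below and hence the contradiction.\<close>
    have n: "n > 0" "norm (w - y) < n"
      using \<open>e > 0\<close> by (auto simp: n_def norm_Pair zero_prod_def real_less_rsqrt add_nonneg_pos)
    have "((\<lambda>v. fst v - x') has_derivative fst) (at (u, w))"
      by (auto intro!: derivative_eq_intros)
    then have d1: "((\<lambda>v. norm (fst v - x')) has_derivative (\<lambda>h. - (a \<bullet> fst h))) (at (u, w))"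
      using \<open>u \<noteq> x'\<close>
      using has_derivative_compose[of "\<lambda>v. fst v - x'" fst "(u, w)" UNIV norm "\<lambda>h. h \<bullet> sgn (u - x')"]
        has_derivative_norm[of "u - x'"]
      by (simp add: a_def inner_commute)
    have "((\<lambda>v. (snd v - y, e)) has_derivative (\<lambda>h. (snd h, 0))) (at (u, w))"
      by (auto intro!: derivative_eq_intros)
    then have d2: "((\<lambda>v. norm (snd v - y, e)) has_derivative (\<lambda>h. l * (b \<bullet> snd h))) (at (u, w))"
      using \<open>e > 0\<close> \<open>l > 0\<close> has_derivative_norm[of "(w - y, e)"]
        has_derivative_compose[of "\<lambda>v. (snd v - y, e)" "\<lambda>h. (snd h, 0)" "(u, w)" UNIV norm
          "\<lambda>h. h \<bullet> sgn (w - y, e)"]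
      by (simp add: b_def n_def sgn_div_norm inner_commute inverse_eq_divide zero_prod_def)
    have "(f has_derivative (\<lambda>h. - ((a, - b) \<bullet> h))) (at (u, w))"
      unfolding f_def case_prod_unfold
      by (rule has_derivative_eq_rhs[OF has_derivative_add[OF d1 bounded_linear.has_derivative[OF bounded_linear_divide d2]]])
         (use \<open>l > 0\<close> in \<open>auto simp: inner_prod_def\<close>)
    then have "(a, - b) \<in> regular_normal_cone (u, w) (gph G)"
      using w min by (intro regular_normal_cone_minimizer) (auto simp: gph_def)
    then have "norm a \<le> l * norm b"
      using bound[OF _ w, of a b] sub(1)[OF fc] by (simp add: regular_coderivative_def c_def)
    moreover have "norm a = 1"
      using \<open>u \<noteq> x'\<close> by (simp add: a_def norm_sgn)
    moreover have "l * norm b < 1"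
      using n \<open>l > 0\<close> by (simp add: b_def)
    ultimately show False
      by simp
  qed
  with w sub(2)[OF fc] \<open>l > 0\<close> show ?thesis
    by (auto simp: c_def algebra_simps)
qed

text \<open>Choosing \<open>e = l * norm (x - x')\<close> absorbs the additive error into a factor
  2. Minimizers then lie within \<open>2 * dist x x' \<le> 4 * r / 5\<close> of \<open>x'\<close>,
  hence within \<open>r\<close> of \<open>c\<close>; this explains the radius
  \<open>r / 5\<close>.\<close>

lemma coderivative_bound_imp_lipschitz:
  fixes G :: "'a::euclidean_space \<Rightarrow> 'b::euclidean_space set"
  assumes cl: "closed (gph G)" and "l > 0"
    and bound: "\<And>u w ys xs. u \<in> cball c r \<Longrightarrow> w \<in> G u \<Longrightarrow>
      xs \<in> regular_coderivative G u w ys \<Longrightarrow> norm xs \<le> l * norm ys"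
    and x: "x \<in> cball c (r / 5)" and x': "x' \<in> cball c (r / 5)" and y: "y \<in> G x"
  shows "\<exists>w\<in>G x'. norm (w - y) \<le> 2 * l * norm (x - x')"
proof (cases "x = x'")
  \<comment> \<open>Treated apart because the chosen \<open>e\<close> would vanish.\<close>
  case True
  with y show ?thesis by auto
next
  case False
  have "norm xs \<le> l * norm ys"
    if "norm (u - x') \<le> norm (x - x') + l * norm (x - x') / l" "w \<in> G u"
      "xs \<in> regular_coderivative G u w ys" for u w xs ys
  proof (rule bound[OF _ that(2,3)])
    have "dist u x' \<le> 2 * dist x x'"
      using that(1) \<open>l > 0\<close> by (simp add: dist_norm)
    moreover have "dist x x' \<le> dist c x + dist c x'"
      by (metis dist_commute dist_triangle)
    moreover have "dist c u \<le> dist c x' + dist u x'"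
      by (metis dist_commute dist_triangle)
    ultimately show "u \<in> cball c r"
      using x x' by (simp add: mem_cball)
  qed
  then have "\<exists>w\<in>G x'. norm (w - y) \<le> l * norm (x - x') + l * norm (x - x')"
    using False \<open>l > 0\<close> y by (intro coderivative_bound_imp_near_point[OF cl]) auto
  then show ?thesis
    by (simp add: algebra_simps)
qed

lemma subset_thickening_iff:
  fixes A B :: "'b::real_normed_vector set"
  assumes "k \<ge> 0"
  shows "A \<subseteq> {y + k *\<^sub>R b | y b. y \<in> B \<and> b \<in> cball 0 1} \<longleftrightarrow> (\<forall>y\<in>A. \<exists>w\<in>B. norm (w - y) \<le> k)"
proof -
  have "(\<exists>b. y = w + k *\<^sub>R b \<and> norm b \<le> 1) \<longleftrightarrow> norm (w - y) \<le> k" for w y :: 'b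
  proof
    assume "\<exists>b. y = w + k *\<^sub>R b \<and> norm b \<le> 1"
    then show "norm (w - y) \<le> k"
      using assms by (auto simp: mult_left_le)
  next
    assume le: "norm (w - y) \<le> k"
    show "\<exists>b. y = w + k *\<^sub>R b \<and> norm b \<le> 1"
    proof (cases "k = 0")
      case True
      with le show ?thesis by (auto intro: exI[of _ 0])
    next
      case False
      with le assms show ?thesis
        by (intro exI[of _ "(1 / k) *\<^sub>R (y - w)"]) (auto simp: norm_minus_commute divide_le_eq)
    qed
  qed
  then show ?thesis
    by (simp add: subset_iff) blast
qed

theorem theorem4p4:
  fixes M :: "'t measure"
    and \<Phi> :: "'t \<Rightarrow> real ^ 'n \<Rightarrow> (real ^ 'm) set"
    and xbar :: "real ^ 'n"
  assumes "complete_measure M" and "finite_measure M"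
    and "set_valued_normal_integrand M \<Phi>"
    and "xbar \<in> set_dom (expected_integral M \<Phi>)"
  shows "integrably_locally_Lipschitzian M \<Phi> xbar \<longleftrightarrow>
    (\<exists>\<eta>>0. \<exists>l\<in>L1_pos M. \<exists>That\<in>sets M. emeasure M (space M - That) = 0 \<and>
       (\<forall>x\<in>cball xbar \<eta>. \<forall>ys. \<forall>t\<in>That. \<forall>y\<in>\<Phi> t x.
          (SUP xs\<in>regular_coderivative (\<Phi> t) x y ys. ereal (norm xs)) \<le> ereal (l t * norm ys)))"
    (is "?L \<longleftrightarrow> ?R")
proof
  assume ?L
  then obtain r l S where *: "r > 0" "l \<in> L1_pos M" "S \<in> sets M" "emeasure M (space M - S) = 0"
    and lip: "\<And>t x x'. t \<in> S \<Longrightarrow> x \<in> cball xbar r \<Longrightarrow> x' \<in> cball xbar r \<Longrightarrow>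
      \<Phi> t x \<subseteq> {y + (l t * norm (x - x')) *\<^sub>R b | y b. y \<in> \<Phi> t x' \<and> b \<in> cball 0 1}"
    unfolding integrably_locally_Lipschitzian_def by blast
  have l: "l t > 0" if "t \<in> S" for t
    using that * sets.sets_into_space by (auto simp: L1_pos_def)
  \<comment> \<open>Halving the radius leaves room to move by \<open>r / 2\<close> from any
    \<open>x\<close> without leaving the ball of \<open>lip\<close>.\<close>
  have "norm xs \<le> l t * norm ys"
    if x: "x \<in> cball xbar (r / 2)" and t: "t \<in> S" and y: "y \<in> \<Phi> t x"
      and xs: "xs \<in> regular_coderivative (\<Phi> t) x y ys" for x ys t y xs
  proof (rule lipschitz_imp_coderivative_bound[OF _ _ y _ xs])
    show "l t \<ge> 0" "r / 2 > 0"
      using l[OF t] *(1) by auto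
    fix x' assume "x' \<in> cball x (r / 2)"
    then have "x' \<in> cball xbar r" "x \<in> cball xbar r"
      using x dist_triangle[of xbar x' x] *(1) by auto
    then have "\<exists>w\<in>\<Phi> t x'. norm (w - y) \<le> l t * norm (x - x')"
      using lip[OF t, of x x'] l[OF t] y by (subst (asm) subset_thickening_iff) auto
    then show "\<exists>w\<in>\<Phi> t x'. norm (w - y) \<le> l t * norm (x' - x)"
      by (simp add: norm_minus_commute)
  qed
  \<comment> \<open>In \<open>ereal\<close> the supremum of the empty set is
    \<open>-\<infinity>\<close>, so an empty coderivative satisfies the estimate, as the convention
    demands.\<close>
  with * show ?R
    by (intro exI[of _ "r / 2"] conjI bexI[of _ l] bexI[of _ S]) (auto intro!: SUP_least)
next
  assume ?R
  then obtain r l S where *: "r > 0" "l \<in> L1_pos M" "S \<in> sets M" "emeasure M (space M - S) = 0"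
    and bound: "\<And>t x y ys. x \<in> cball xbar r \<Longrightarrow> t \<in> S \<Longrightarrow> y \<in> \<Phi> t x \<Longrightarrow>
      (SUP xs\<in>regular_coderivative (\<Phi> t) x y ys. ereal (norm xs)) \<le> ereal (l t * norm ys)"
    by blast
  have S: "l t > 0" "closed (gph (\<Phi> t))" if "t \<in> S" for t
    using sets.sets_into_space[OF *(3)] that *(2) assms(3)
    by (auto simp: L1_pos_def set_valued_normal_integrand_def)
  have "\<Phi> t x \<subseteq> {y + (2 * l t * norm (x - x')) *\<^sub>R b | y b. y \<in> \<Phi> t x' \<and> b \<in> cball 0 1}"
    if t: "t \<in> S" and x: "x \<in> cball xbar (r / 5)" and x': "x' \<in> cball xbar (r / 5)" for t x x'
  proof -
    have "norm xs \<le> l t * norm ys"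
      if "u \<in> cball xbar r" "w \<in> \<Phi> t u" "xs \<in> regular_coderivative (\<Phi> t) u w ys" for u w ys xs
      using bound[OF that(1) t that(2), of ys] that(3) by (simp add: SUP_le_iff)
    then have "\<exists>w\<in>\<Phi> t x'. norm (w - y) \<le> 2 * l t * norm (x - x')" if "y \<in> \<Phi> t x" for y
      using coderivative_bound_imp_lipschitz[OF S(2,1)[OF t] _ x x' that] by blast
    then show ?thesis
      using S(1)[OF t] by (subst subset_thickening_iff) auto
  qed
  \<comment> \<open>The factor 2 lost in the pointwise estimate preserves integrability and
    positivity, and the full-measure set \<open>S\<close> is kept.\<close>
  moreover have "(\<lambda>t. 2 * l t) \<in> L1_pos M"
    using *(2) by (simp add: L1_pos_def)
  ultimately show ?L
    unfolding integrably_locally_Lipschitzian_def using *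
    by (intro exI[of _ "r / 5"] conjI bexI[of _ "\<lambda>t. 2 * l t"] bexI[of _ S]) auto
qed

end
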